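(* Let $k \ge 1$ and let $S = \{T_3, T_4, \ldots, T_{k+2}\}$ be the set of numbers of cookies in $k$ jars, where $T_i$ denotes the Tribonacci numbers. Then $\mathrm{CM}(S) = \left\lfloor \frac{2k}{3} \right\rfloor + 1$.
   Context: The Tribonacci sequence is defined by $T_0 = 0$, $T_1 = 0$, $T_2 = 1$, and $T_i = T_{i-1} + T_{i-2} + T_{i-3}$ for $i \ge 3$ (so it begins $0, 0, 1, 1, 2, 4, 7, 13, 24, 44, \ldots$). A set $S = \{j_1 < j_2 < \cdots < j_k\}$ of distinct positive integers represents $k$ jars, where the $i$-th jar initially contains $j_i$ cookies. A move consists of choosing any subset of the jars and a positive integer $a$, such that every chosen jar currently contains at least $a$ cookies, and removing exactly $a$ cookies from each chosen jar (the same number from each). The Cookie Monster number $\mathrm{CM}(S)$ is the minimum number of moves needed to empty all of the jars. *)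

theory Defs
  imports Complex_Main
begin

fun tribonacci :: "nat \<Rightarrow> nat" where
  "tribonacci 0 = 0"
| "tribonacci (Suc 0) = 0"
| "tribonacci (Suc (Suc 0)) = 1"
| "tribonacci (Suc (Suc (Suc n))) =
     tribonacci (Suc (Suc n)) + tribonacci (Suc n) + tribonacci n"

(* The state of the jars with labels in J is a function giving the current
   number of cookies in each jar. Only jars in J can be chosen, so values outside J
   never change and are irrelevant. *)
definition cookie_move :: "'j set \<Rightarrow> ('j \<Rightarrow> nat) \<Rightarrow> ('j \<Rightarrow> nat) \<Rightarrow> bool" where
  "cookie_move J c c' \<longleftrightarrow>
     (\<exists>A a. A \<subseteq> J \<and> a > 0 \<and> (\<forall>j\<in>A. a \<le> c j) \<and>
            c' = (\<lambda>j. if j \<in> A then c j - a else c j))"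

(* The initial contents are pairwise distinct, so each jar is labelled by its own initial
   content and the initial state is the identity. For a finite set S the
   minimum exists, since the jars can be emptied one at a time. *)
definition cookie_monster_number :: "nat set \<Rightarrow> nat" where
  "cookie_monster_number S =
     (LEAST n. \<exists>c. (cookie_move S ^^ n) (\<lambda>j. j) c \<and> (\<forall>j\<in>S. c j = 0))"

end

theory Submission
  imports Defs
begin

text \<open>
  Only the amounts that are removed matter: the jars can be emptied in \<open>n\<close> moves iff there are
  \<open>n\<close> amounts such that every jar content is a sum of some of them
  (\<open>emptied_iff_subset_sums\<close>).

  For the lower bound, suppose that one jar holds more cookies than all smaller jars together.
  The moves applied to the smaller jars remove at most the total content of those jars, so they
  cannot empty the large jar, and some move is applied to the large jar but to no smaller one.
  Discarding that move and that jar and iterating shows that a superincreasing family of contents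
  needs as many moves as it has members (\<open>superincreasing_card_le\<close>). If, moreover,
  every jar content is a sum of distinct members of such a family, then the members themselves
  serve as optimal amounts (\<open>cookie_monster_number_superincreasing_generators\<close>).

  Such a family exists among the Tribonacci numbers: drop every \<open>T\<^sub>i\<close> with \<open>3\<close>
  dividing \<open>i\<close>, except \<open>T\<^sub>3\<close>, which leaves \<open>1, 2, 4, 13, 24, 81, 149, \<dots>\<close>. Unfolding
  the recurrence at the index divisible by three again and again gives
  \<open>T\<^bsub>3m+3\<^esub> = T\<^bsub>3m+2\<^esub> + T\<^bsub>3m+1\<^esub> + T\<^bsub>3m-1\<^esub> + T\<^bsub>3m-2\<^esub> + \<cdots> + T\<^sub>5 + T\<^sub>4 + T\<^sub>3\<close>,
  so a dropped number is the sum of all the kept numbers below it. The same identity evaluates the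
  sums of kept numbers and shows that they form a superincreasing family. Among the \<open>k\<close>
  indices from \<open>3\<close> to \<open>k + 2\<close>, there are \<open>\<lfloor>2k/3\<rfloor> + 1\<close> kept ones.
\<close>

section \<open>Moves as subset sums\<close>

text \<open>
  The contents are an arbitrary function \<open>c\<close> so that the induction can peel off the first move.
  Amounts equal to zero are harmless, because a move may choose no jar at all.
\<close>

lemma emptied_iff_subset_sums:
  "(\<exists>c'. (cookie_move J ^^ n) c c' \<and> (\<forall>j\<in>J. c' j = 0)) \<longleftrightarrow>
   (\<exists>a :: nat \<Rightarrow> nat. c ` J \<subseteq> sum a ` Pow {..<n})"
proof (induction n arbitrary: c)
  case 0
  show ?case by auto
next
  case (Suc n)
  have step: "(\<exists>c'. (cookie_move J ^^ Suc n) c c' \<and> (\<forall>j\<in>J. c' j = 0)) \<longleftrightarrow>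
    (\<exists>d. cookie_move J c d \<and> (\<exists>a :: nat \<Rightarrow> nat. d ` J \<subseteq> sum a ` Pow {..<n}))"
    unfolding Suc.IH[symmetric] by (blast dest: relpowp_Suc_D2 intro: relpowp_Suc_I2)
  show ?case
    unfolding step
  proof (intro iffI; elim exE conjE)
    fix d and a :: "nat \<Rightarrow> nat"
    assume move: "cookie_move J c d" and d: "d ` J \<subseteq> sum a ` Pow {..<n}"
    from move obtain A x where A: "\<forall>j\<in>A. x \<le> c j"
      and d_def: "d = (\<lambda>j. if j \<in> A then c j - x else c j)"
      unfolding cookie_move_def by blast
    have "c j \<in> sum (a(n := x)) ` Pow {..<Suc n}" if "j \<in> J" for j
    proof -
      from d that obtain B where B: "B \<subseteq> {..<n}" "d j = sum a B" by auto
      then have fin: "finite B" and n: "n \<notin> B" by (auto intro: finite_subset)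
      have same: "sum (a(n := x)) B = d j"
        using B n by (auto intro!: sum.cong)
      show ?thesis
      proof (cases "j \<in> A")
        case True
        then have "c j = sum (a(n := x)) (insert n B)"
          using A fin n same by (simp add: d_def)
        then show ?thesis using B by (intro image_eqI[of _ _ "insert n B"]) auto
      next
        case False
        then have "c j = sum (a(n := x)) B"
          using same by (simp add: d_def)
        then show ?thesis using B by (intro image_eqI[of _ _ B]) auto
      qed
    qed
    then show "\<exists>a :: nat \<Rightarrow> nat. c ` J \<subseteq> sum a ` Pow {..<Suc n}" by blast
  next
    fix a :: "nat \<Rightarrow> nat"
    assume "c ` J \<subseteq> sum a ` Pow {..<Suc n}"
    then have "\<forall>j\<in>J. \<exists>B. B \<subseteq> {..<Suc n} \<and> c j = sum a B" by blast
    from bchoice[OF this] obtain B where B: "\<And>j. j \<in> J \<Longrightarrow> B j \<subseteq> {..<Suc n}"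
      and c: "\<And>j. j \<in> J \<Longrightarrow> c j = sum a (B j)"
      by blast
    have fin: "finite (B j)" if "j \<in> J" for j
      using B[OF that] finite_subset by blast
    \<comment> \<open>A move removes a positive amount; if \<open>a n = 0\<close>, then \<open>A\<close> is empty and the amount
      \<open>1\<close> is an arbitrary choice.\<close>
    define A where "A = {j \<in> J. n \<in> B j \<and> a n > 0}"
    define d where "d = (\<lambda>j. if j \<in> A then c j - max 1 (a n) else c j)"
    have "max 1 (a n) \<le> c j" if "j \<in> A" for j
      using that c[of j] member_le_sum[of n "B j" a] fin[of j] by (auto simp: A_def)
    then have "cookie_move J c d"
      unfolding cookie_move_def d_def
      by (intro exI[of _ A] exI[of _ "max 1 (a n)"]) (auto simp: A_def)
    moreover have "d j \<in> sum a ` Pow {..<n}" if "j \<in> J" for j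
    proof -
      have "d j = sum a (B j - {n})"
        using c[OF that] fin[OF that] that sum_diff1_nat[of a "B j" n]
        by (auto simp: d_def A_def max_def)
      moreover have "B j - {n} \<subseteq> {..<n}" using B[OF that] by auto
      ultimately show ?thesis by blast
    qed
    ultimately show "\<exists>d. cookie_move J c d \<and> (\<exists>a :: nat \<Rightarrow> nat. d ` J \<subseteq> sum a ` Pow {..<n})"
      by blast
  qed
qed

lemma cookie_monster_number_subset_sums:
  "cookie_monster_number S = (LEAST n. \<exists>a :: nat \<Rightarrow> nat. S \<subseteq> sum a ` Pow {..<n})"
  unfolding cookie_monster_number_def emptied_iff_subset_sums by simp

section \<open>Superincreasing families\<close>

text \<open>
  Induction on the family, adding its members in increasing order: the amounts used by the
  smaller members cannot add up to the largest one, so it uses an amount that no other member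
  uses, and that amount can be discarded.
\<close>

lemma superincreasing_card_le:
  fixes f :: "'i :: linorder \<Rightarrow> nat" and a :: "'n \<Rightarrow> nat"
  assumes "finite I" and "finite N"
    and "\<And>i. i \<in> I \<Longrightarrow> (\<Sum>j | j \<in> I \<and> j < i. f j) < f i"
    and "f ` I \<subseteq> sum a ` Pow N"
  shows "card I \<le> card N"
  using assms
proof (induction I arbitrary: N rule: finite_linorder_max_induct)
  case empty
  then show ?case by simp
next
  case (insert m I)
  from insert.prems(3) have "\<forall>i\<in>insert m I. \<exists>B. B \<subseteq> N \<and> f i = sum a B"
    by blast
  from bchoice[OF this] obtain B
    where choice: "\<forall>i\<in>insert m I. B i \<subseteq> N \<and> f i = sum a (B i)" ..
  have B: "B i \<subseteq> N" and f: "f i = sum a (B i)" if "i \<in> insert m I" for i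
    using bspec[OF choice that] by simp_all
  have fin: "finite (B i)" if "i \<in> insert m I" for i
    using B[OF that] insert.prems(1) finite_subset by blast
  have below_m: "{j. j \<in> insert m I \<and> j < m} = I"
    using insert.hyps by auto
  have "\<not> B m \<subseteq> (\<Union>i\<in>I. B i)"
  proof
    assume sub: "B m \<subseteq> (\<Union>i\<in>I. B i)"
    have "f m = sum a (B m)"
      using f by simp
    also have "\<dots> \<le> (\<Sum>p\<in>Sigma I B. a (snd p))"
    proof (rule sum_le_included[where i = snd])
      show "finite (B m)" using fin by simp
      show "finite (Sigma I B)" using insert.hyps(1) fin by (intro finite_SigmaI) auto
      show "\<forall>x\<in>B m. \<exists>p\<in>Sigma I B. snd p = x \<and> a x \<le> a (snd p)" using sub by fastforce
    qed simp
    also have "\<dots> = (\<Sum>i\<in>I. sum a (B i))"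
      using insert.hyps(1) fin by (subst sum.Sigma) (auto simp: case_prod_unfold)
    also have "\<dots> = (\<Sum>i\<in>I. f i)"
      using f by (intro sum.cong) auto
    also have "\<dots> < f m"
      using insert.prems(2)[of m] by (simp only: below_m) simp
    finally show False by simp
  qed
  then obtain x where x: "x \<in> B m" "x \<notin> (\<Union>i\<in>I. B i)" by blast
  have "card I \<le> card (N - {x})"
  proof (rule insert.IH)
    show "finite (N - {x})" using insert.prems(1) by simp
    show "(\<Sum>j | j \<in> I \<and> j < i. f j) < f i" if "i \<in> I" for i
    proof -
      have "{j. j \<in> I \<and> j < i} = {j. j \<in> insert m I \<and> j < i}"
        using insert.hyps(2) that by force
      then show ?thesis using insert.prems(2)[of i] that by simp
    qed
    show "f ` I \<subseteq> sum a ` Pow (N - {x})"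
    proof
      fix y assume "y \<in> f ` I"
      then obtain i where i: "i \<in> I" "y = f i" by blast
      then have "B i \<subseteq> N - {x}" using B x(2) by blast
      then show "y \<in> sum a ` Pow (N - {x})" using f i by blast
    qed
  qed
  moreover have "card N = Suc (card (N - {x}))"
    using insert.prems(1) x(1) B by (intro card.remove) auto
  moreover have "m \<notin> I" using insert.hyps(2) by blast
  ultimately show ?case
    using insert.hyps(1) by simp
qed

lemma cookie_monster_number_superincreasing_generators:
  fixes f :: "'i :: linorder \<Rightarrow> nat"
  assumes "finite I"
    and superinc: "\<And>i. i \<in> I \<Longrightarrow> (\<Sum>j | j \<in> I \<and> j < i. f j) < f i"
    and "f ` I \<subseteq> S" and generate: "S \<subseteq> sum f ` Pow I"
  shows "cookie_monster_number S = card I"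
  unfolding cookie_monster_number_subset_sums
proof (rule Least_equality)
  obtain h where h: "bij_betw h {..<card I} I"
    using ex_bij_betw_nat_finite[OF \<open>finite I\<close>] by (auto simp: lessThan_atLeast0)
  have "sum f B \<in> sum (f \<circ> h) ` Pow {..<card I}" if "B \<subseteq> I" for B
  proof -
    from that have "B \<subseteq> h ` {..<card I}" using bij_betw_imp_surj_on[OF h] by simp
    then obtain A where A: "A \<subseteq> {..<card I}" "B = h ` A" by (rule subset_imageE)
    moreover have "inj_on h A"
      using h A(1) bij_betw_imp_inj_on inj_on_subset by blast
    ultimately show ?thesis by (auto simp: sum.reindex)
  qed
  then have "sum f ` Pow I \<subseteq> sum (f \<circ> h) ` Pow {..<card I}" by blast
  with generate have "S \<subseteq> sum (f \<circ> h) ` Pow {..<card I}" by (rule order_trans)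
  then show "\<exists>a :: nat \<Rightarrow> nat. S \<subseteq> sum a ` Pow {..<card I}" by (rule exI[of _ "f \<circ> h"])
next
  fix n
  assume "\<exists>a :: nat \<Rightarrow> nat. S \<subseteq> sum a ` Pow {..<n}"
  then obtain a :: "nat \<Rightarrow> nat" where "S \<subseteq> sum a ` Pow {..<n}" ..
  with \<open>f ` I \<subseteq> S\<close> have "f ` I \<subseteq> sum a ` Pow {..<n}" by (rule order_trans)
  with \<open>finite I\<close> finite_lessThan superinc have "card I \<le> card {..<n}"
    by (rule superincreasing_card_le)
  then show "card I \<le> n" by simp
qed

section \<open>Tribonacci numbers\<close>

text \<open>
  The index \<open>3\<close> is kept although \<open>3\<close> divides it: nothing smaller is available to
  generate \<open>T\<^sub>3\<close>.
\<close>

definition kept :: "nat set" where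
  "kept = {i. i = 3 \<or> 3 \<le> i \<and> \<not> 3 dvd i}"

lemma tribonacci_pos: "tribonacci (n + 2) > 0"
  by (induction n) (auto simp: numeral_2_eq_2)

lemma kept_below_Suc:
  "{i \<in> kept. i < Suc n} = (if n \<in> kept then insert n {i \<in> kept. i < n} else {i \<in> kept. i < n})"
  by (auto simp: less_Suc_eq)

text \<open>
  The bound is \<open>3 * m + 4\<close> rather than \<open>3 * m + 3\<close> so that the identity also holds
  for \<open>m = 0\<close>, where \<open>T\<^sub>3\<close> itself is kept.
\<close>

lemma sum_kept_below:
  "(\<Sum>i | i \<in> kept \<and> i < 3 * m + 4. tribonacci i) = tribonacci (3 * m + 3)"
proof (induction m)
  case 0
  have "{i. i \<in> kept \<and> i < 4} = {3}" by (auto simp: kept_def)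
  then show ?case by (simp add: numeral_eq_Suc)
next
  case (Suc m)
  have "{i. i \<in> kept \<and> i < 3 * Suc m + 4} =
      insert (3 * m + 5) (insert (3 * m + 4) {i. i \<in> kept \<and> i < 3 * m + 4})"
    unfolding kept_def by (rule set_eqI) (simp; presburger)
  then have "(\<Sum>i | i \<in> kept \<and> i < 3 * Suc m + 4. tribonacci i) =
      tribonacci (3 * m + 5) + tribonacci (3 * m + 4) + tribonacci (3 * m + 3)"
    by (simp add: Suc.IH)
  also have "\<dots> = tribonacci (3 * Suc m + 3)"
    by (simp add: numeral_eq_Suc)
  finally show ?case .
qed

lemma kept_superincreasing:
  assumes "i \<in> kept"
  shows "(\<Sum>j | j \<in> kept \<and> j < i. tribonacci j) < tribonacci i"
proof -
  have "i = 3 \<or> (\<exists>m. i = 3 * m + 4) \<or> (\<exists>m. i = 3 * m + 5)"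
    using assms unfolding kept_def by (simp, presburger)
  then consider "i = 3" | m where "i = 3 * m + 4" | m where "i = 3 * m + 5" by blast
  then show ?thesis
  proof cases
    case 1
    have "{j. j \<in> kept \<and> j < 3} = {}" by (auto simp: kept_def)
    then have "(\<Sum>j | j \<in> kept \<and> j < i. tribonacci j) = 0" using 1 by (simp only: sum.empty)
    then show ?thesis using 1 tribonacci_pos[of 1] by (simp add: numeral_3_eq_3)
  next
    case (2 m)
    have "tribonacci (3 * m + 4) =
        tribonacci (3 * m + 3) + tribonacci (3 * m + 2) + tribonacci (3 * m + 1)"
      by (simp add: numeral_eq_Suc)
    then show ?thesis
      using 2 tribonacci_pos[of "3 * m"] by (simp add: sum_kept_below)
  next
    case (3 m)
    have "3 * m + 4 \<in> kept" unfolding kept_def by (simp, presburger)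
    then have "{j. j \<in> kept \<and> j < 3 * m + 5} =
        insert (3 * m + 4) {j. j \<in> kept \<and> j < 3 * m + 4}"
      by auto
    moreover have "tribonacci (3 * m + 5) =
        tribonacci (3 * m + 4) + tribonacci (3 * m + 3) + tribonacci (3 * m + 2)"
      by (simp add: numeral_eq_Suc)
    ultimately show ?thesis
      using 3 tribonacci_pos[of "3 * m"] by (simp add: sum_kept_below)
  qed
qed

lemma tribonacci_sum_of_kept:
  assumes "3 \<le> i" and "i < n"
  shows "tribonacci i \<in> sum tribonacci ` Pow {j. j \<in> kept \<and> j < n}"
proof (cases "i \<in> kept")
  case True
  then show ?thesis using assms by (intro image_eqI[of _ _ "{i}"]) auto
next
  case False
  then have "\<exists>m. i = 3 * m + 3"
    using assms(1) unfolding kept_def by (simp, presburger)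
  then obtain m where m: "i = 3 * m + 3" ..
  then have "tribonacci i = sum tribonacci {j. j \<in> kept \<and> j < 3 * m + 4}"
    by (simp add: sum_kept_below)
  then show ?thesis using m assms(2) by (intro image_eqI) auto
qed

lemma card_kept_below:
  assumes "k \<ge> 1"
  shows "card {i. i \<in> kept \<and> i < k + 3} = 2 * k div 3 + 1"
  using assms
proof (induction k rule: nat_induct_at_least)
  case base
  have "{i. i \<in> kept \<and> i < 1 + 3} = {3}" by (auto simp: kept_def)
  then show ?case by simp
next
  case (Suc k)
  have "k + 3 \<in> kept \<longleftrightarrow> \<not> 3 dvd k"
    using Suc.hyps by (auto simp: kept_def)
  moreover have "2 * Suc k div 3 = 2 * k div 3 + (if 3 dvd k then 0 else 1)"
    by presburger
  ultimately show ?case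
    using Suc.IH kept_below_Suc[of "k + 3"] by simp
qed

theorem theorem5:
  fixes k :: nat
  assumes "k \<ge> 1"
  shows "int (cookie_monster_number (tribonacci ` {3..k + 2})) = \<lfloor>2 * real k / 3\<rfloor> + 1"
proof -
  let ?I = "{i. i \<in> kept \<and> i < k + 3}"
  have "cookie_monster_number (tribonacci ` {3..k + 2}) = card ?I"
  proof (rule cookie_monster_number_superincreasing_generators)
    show "finite ?I" by simp
    show "(\<Sum>j | j \<in> ?I \<and> j < i. tribonacci j) < tribonacci i" if "i \<in> ?I" for i
    proof -
      have "{j. j \<in> ?I \<and> j < i} = {j. j \<in> kept \<and> j < i}" using that by auto
      then show ?thesis using kept_superincreasing that by simp
    qed
    show "tribonacci ` ?I \<subseteq> tribonacci ` {3..k + 2}"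
      by (intro image_mono) (auto simp: kept_def)
    show "tribonacci ` {3..k + 2} \<subseteq> sum tribonacci ` Pow ?I"
      using tribonacci_sum_of_kept[of _ "k + 3"] by auto
  qed
  then have "int (cookie_monster_number (tribonacci ` {3..k + 2})) = int (2 * k div 3) + 1"
    using card_kept_below[OF assms] by simp
  also have "int (2 * k div 3) = \<lfloor>2 * real k / 3\<rfloor>"
    using floor_divide_of_nat_eq[of "2 * k" 3, where ?'a = real] by simp
  finally show ?thesis .
qed

end
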